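(* Let $k^t,k^d\in\mathbb{N}$ be such that $\frac{k^d}{k^t}$ is an integer, and let $\alpha>0$. Then the best-case drone-impact ratio of the policy Regretless satisfies $$\underline{\omega}(\mathrm{Regretless})\ \le\ \frac{1}{1+\alpha\frac{k^d}{k^t}}.$$
   Context: Relief distribution problem (RDP). $\mathbb{N}=\{1,2,\dots\}$. An instance is $I=(k^t,k^d,\alpha,G,D)$: $k^t,k^d\in\mathbb{N}$ are the numbers of trucks and drones; $\alpha>0$ is the drone speed; $G=(V,E,c)$ is a finite connected undirected graph (not necessarily complete) with $V=\{v_0\}\cup C$, where $v_0$ is the depot and $C\neq\emptyset$ is the set of non-depot nodes; edge lengths $c(i,j)>0$ satisfy the triangle inequality; $D\subseteq C$ is the set of damaged nodes, initially unknown; the status of a node is revealed (instantly to all) when some vehicle first arrives at it. For non-adjacent $i,j$, $c(i,j)$ is the shortest-path distance. A truck needs time $c(i,j)$ to traverse an edge, a drone needs $\frac1\alpha c(i,j)$. A tour is a closed walk in $G$ starting and ending at $v_0$ (possibly of length $0$); it may be written as a sequence of nodes, consecutive nodes being joined by shortest paths, and $c(t)$ is the length of tour $t$. The makespan of a family of tours is the maximum duration of a tour. For integers $m,n\ge 0$ with $m+n\ge1$ and $W\subseteq C$, $\mathrm{TSP}_{m,n}(W)$ denotes the minimum makespan over all families of $m$ truck tours and $n$ drone tours that together visit all nodes of $W$, and $S^*_{m,n}(W)$ denotes an optimal such family. Policy Regretless (deterministic; choices among optimal solutions are made by a fixed rule using only the information available at that time). First stage: compute $S^*_{k^t,0}(C)=\{s^*_1,\dots,s^*_{k^t}\}$,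 written as $s^*_i=(v_0,v_{(1)},\dots,v_{(n_i)},v_0)$ so that each node of $C$ is listed exactly once in exactly one tour. Assign one truck to each tour and distribute the drones as evenly as possible, so each tour receives $\lceil k^d/k^t\rceil$ or $\lfloor k^d/k^t\rfloor$ drones; let $k_i$ be the number of vehicles assigned to $s_i^*$. Split $(v_{(1)},\dots,v_{(n_i)})$ into up to $k_i$ consecutive nonempty segments $\Delta_i^l=(v_{(j_l)},\dots,v_{(j_{l+1}-1)})$, $j_1=1$; the truck is assigned the tour $t_i^1=(v_0,v_{(1)},\dots,v_{(j_2-1)},v_0)$ and each further segment $l\ge2$ is assigned to one drone, with the reversed tour $t_i^l=(v_0,v_{(j_{l+1}-1)},\dots,v_{(j_l)},v_0)$; the splitting is chosen to minimize $\max\{c(t_i^1),\max_{l\ge2} c(t_i^l)/\alpha\}$. All vehicles start at time $0$. Second stage (replanning), for each $i$: when truck $i$ reaches the last node $v_{(j_2-1)}$ of its segment, let $D_i^d$ be the set of damaged nodes of $s_i^*$ not yet visited by the truck and $C_i^d$ the set of nodes of $s_i^*$ not yet visited by any vehicle; the truck then follows a minimum-length walk from its current node visiting all of $D_i^d\cup C_i^d$ and ending at $v_0$. The drones complete their tours. $\mathrm{Regretless}(I)$ is the time at which the last vehicle has returned to $v_0$. Best-case drone-impact ratio: $\underline{\omega}(\mathrm{Regretless})=\inf_I \frac{\mathrm{Regretless}(I)}{\mathrm{TSP}_{k^t,0}(C)}$, the infimum being over all instances $I$ with the given $k^t,k^d,\alpha$ (and $C=C(I)$). *)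

theory Defs
  imports "Graph_Theory.Graph_Theory"
begin

section \<open>Networks\<close>

type_synonym 'v route = "('v \<times> 'v) awalk"

text \<open>
  The undirected graph is a symmetric digraph, and walks are the arc walks of the
  library. The damaged set is kept apart from the network, since the vehicles do not
  know it initially.
\<close>

record 'v network =
  net_graph :: "'v pair_pre_digraph"
  depot :: 'v
  edge_len :: "('v \<times> 'v) weight_fun"

abbreviation walk :: "'v network \<Rightarrow> 'v \<Rightarrow> 'v route \<Rightarrow> 'v \<Rightarrow> bool" where
  "walk N \<equiv> pre_digraph.awalk (with_proj (net_graph N))"

abbreviation walk_nodes :: "'v network \<Rightarrow> 'v \<Rightarrow> 'v route \<Rightarrow> 'v list" where
  "walk_nodes N \<equiv> pre_digraph.awalk_verts (with_proj (net_graph N))"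

abbreviation walk_len :: "'v network \<Rightarrow> 'v route \<Rightarrow> real" where
  "walk_len N \<equiv> wf_digraph.awalk_cost (edge_len N)"

definition customers :: "'v network \<Rightarrow> 'v set" where
  "customers N = pverts (net_graph N) - {depot N}"

text \<open>The extension of the edge lengths to all pairs of nodes.\<close>

definition cdist :: "'v network \<Rightarrow> 'v \<Rightarrow> 'v \<Rightarrow> real" where
  "cdist N u v =
     (if (u, v) \<in> parcs (net_graph N) then edge_len N (u, v)
      else real_of_ereal (wf_digraph.\<mu> (with_proj (net_graph N)) (edge_len N) u v))"

text \<open>
  The triangle inequality is required of the extended lengths, on all triples of nodes.
  \<open>connected\<close> is qualified because there is also the topological constant.
\<close>

definition is_network :: "'v network \<Rightarrow> bool" where
  "is_network N \<longleftrightarrow>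
     pair_graph (net_graph N) \<and>
     Digraph_Component.connected (with_proj (net_graph N)) \<and>
     depot N \<in> pverts (net_graph N) \<and>
     customers N \<noteq> {} \<and>
     (\<forall>(u, v) \<in> parcs (net_graph N).
        0 < edge_len N (u, v) \<and> edge_len N (u, v) = edge_len N (v, u)) \<and>
     (\<forall>u \<in> pverts (net_graph N). \<forall>v \<in> pverts (net_graph N). \<forall>w \<in> pverts (net_graph N).
        cdist N u w \<le> cdist N u v + cdist N v w)"


section \<open>Tours\<close>

definition tour :: "'v network \<Rightarrow> 'v route \<Rightarrow> bool" where
  "tour N p \<longleftrightarrow> walk N (depot N) p (depot N)"

text \<open>
  A family consists of \<open>m\<close> truck tours \<open>t 0, \<dots>, t (m - 1)\<close> and \<open>n\<close> drone tours
  \<open>d 0, \<dots>, d (n - 1)\<close>; the values of \<open>t\<close> and \<open>d\<close> at other indices are irrelevant.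
\<close>

definition covering_family ::
  "'v network \<Rightarrow> nat \<Rightarrow> nat \<Rightarrow> 'v set \<Rightarrow> (nat \<Rightarrow> 'v route) \<Rightarrow> (nat \<Rightarrow> 'v route) \<Rightarrow> bool" where
  "covering_family N m n W t d \<longleftrightarrow>
     (\<forall>i<m. tour N (t i)) \<and> (\<forall>j<n. tour N (d j)) \<and>
     W \<subseteq> (\<Union>i<m. set (walk_nodes N (depot N) (t i))) \<union>
         (\<Union>j<n. set (walk_nodes N (depot N) (d j)))"

definition makespan ::
  "real \<Rightarrow> 'v network \<Rightarrow> nat \<Rightarrow> nat \<Rightarrow> (nat \<Rightarrow> 'v route) \<Rightarrow> (nat \<Rightarrow> 'v route) \<Rightarrow> real" where
  "makespan \<alpha> N m n t d =
     Max ((\<lambda>i. walk_len N (t i)) ` {..<m} \<union> (\<lambda>j. walk_len N (d j) / \<alpha>) ` {..<n})"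

definition TSP :: "real \<Rightarrow> 'v network \<Rightarrow> nat \<Rightarrow> nat \<Rightarrow> 'v set \<Rightarrow> real" where
  "TSP \<alpha> N m n W = Inf {makespan \<alpha> N m n t d | t d. covering_family N m n W t d}"

definition optimal_family ::
  "real \<Rightarrow> 'v network \<Rightarrow> nat \<Rightarrow> nat \<Rightarrow> 'v set \<Rightarrow> (nat \<Rightarrow> 'v route) \<Rightarrow> (nat \<Rightarrow> 'v route) \<Rightarrow> bool" where
  "optimal_family \<alpha> N m n W t d \<longleftrightarrow>
     covering_family N m n W t d \<and> makespan \<alpha> N m n t d = TSP \<alpha> N m n W"

text \<open>
  \<open>written_as N xs p\<close>: the walk \<open>p\<close> arises from the node sequence \<open>xs\<close> by joining
  consecutive nodes by shortest paths. For equal consecutive nodes this is the empty walk.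
\<close>

fun written_as :: "'v network \<Rightarrow> 'v list \<Rightarrow> 'v route \<Rightarrow> bool" where
  "written_as N [] p \<longleftrightarrow> False"
| "written_as N [u] p \<longleftrightarrow> u \<in> pverts (net_graph N) \<and> p = []"
| "written_as N (u # v # xs) p \<longleftrightarrow>
     (\<exists>q r. p = q @ r \<and> walk N u q v \<and> walk_len N q = cdist N u v \<and> written_as N (v # xs) r)"

fun seq_len :: "'v network \<Rightarrow> 'v list \<Rightarrow> real" where
  "seq_len N (u # v # xs) = cdist N u v + seq_len N (v # xs)"
| "seq_len N _ = 0"

definition loop :: "'v network \<Rightarrow> 'v list \<Rightarrow> 'v list" where
  "loop N xs = depot N # xs @ [depot N]"


section \<open>First stage\<close>

text \<open>
  Tours are indexed by \<open>i < k\<^sup>t\<close>, the segments of tour \<open>i\<close> by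
  \<open>l < length (segments F i)\<close>. Segment \<open>0\<close> belongs to the truck, and for \<open>l \<ge> 1\<close> the walk
  \<open>drone_tour F i l\<close> is flown by the drone assigned to segment \<open>l\<close>. The walk
  \<open>truck_out F i\<close> leads the truck from the depot to the last node of its segment; what
  follows is decided in the second stage.
\<close>

record 'v first_stage =
  opt_tour :: "nat \<Rightarrow> 'v route"
  node_seq :: "nat \<Rightarrow> 'v list"
  num_drones :: "nat \<Rightarrow> nat"
  segments :: "nat \<Rightarrow> 'v list list"
  truck_out :: "nat \<Rightarrow> 'v route"
  drone_tour :: "nat \<Rightarrow> nat \<Rightarrow> 'v route"

text \<open>A tour without customers has no segments; its truck stays at the depot.\<close>

definition truck_segment :: "'v list list \<Rightarrow> 'v list" where
  "truck_segment S = (case S of [] \<Rightarrow> [] | s # _ \<Rightarrow> s)"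

definition is_split :: "'v list \<Rightarrow> nat \<Rightarrow> 'v list list \<Rightarrow> bool" where
  "is_split xs k S \<longleftrightarrow> concat S = xs \<and> [] \<notin> set S \<and> length S \<le> k"

definition split_value :: "real \<Rightarrow> 'v network \<Rightarrow> 'v list list \<Rightarrow> real" where
  "split_value \<alpha> N S =
     Max (insert (seq_len N (loop N (truck_segment S)))
            ((\<lambda>s. seq_len N (loop N (rev s)) / \<alpha>) ` set (tl S)))"

definition optimal_split :: "real \<Rightarrow> 'v network \<Rightarrow> 'v list \<Rightarrow> nat \<Rightarrow> 'v list list \<Rightarrow> bool" where
  "optimal_split \<alpha> N xs k S \<longleftrightarrow>
     is_split xs k S \<and> (\<forall>S'. is_split xs k S' \<longrightarrow> split_value \<alpha> N S \<le> split_value \<alpha> N S')"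

definition regretless_first_stage ::
  "nat \<Rightarrow> nat \<Rightarrow> real \<Rightarrow> 'v network \<Rightarrow> 'v first_stage \<Rightarrow> bool" where
  "regretless_first_stage kt kd \<alpha> N F \<longleftrightarrow>
     optimal_family \<alpha> N kt 0 (customers N) (opt_tour F) (\<lambda>_. []) \<and>
     (\<forall>i<kt. written_as N (loop N (node_seq F i)) (opt_tour F i)) \<and>
     distinct (concat (map (node_seq F) [0..<kt])) \<and>
     set (concat (map (node_seq F) [0..<kt])) = customers N \<and>
     (\<forall>i<kt. int (num_drones F i) \<in> {\<lceil>real kd / real kt\<rceil>, \<lfloor>real kd / real kt\<rfloor>}) \<and>
     (\<Sum>i<kt. num_drones F i) = kd \<and>
     (\<forall>i<kt. optimal_split \<alpha> N (node_seq F i) (1 + num_drones F i) (segments F i)) \<and>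
     (\<forall>i<kt. written_as N (depot N # truck_segment (segments F i)) (truck_out F i)) \<and>
     (\<forall>i<kt. \<forall>l \<in> {1..<length (segments F i)}.
        written_as N (loop N (rev (segments F i ! l))) (drone_tour F i l))"


section \<open>Second stage\<close>

text \<open>
  The nodes at which a vehicle of the given speed, which leaves the depot at time \<open>0\<close> along
  \<open>p\<close>, has arrived by time \<open>\<tau>\<close>.
\<close>

definition visited_by :: "'v network \<Rightarrow> real \<Rightarrow> 'v route \<Rightarrow> real \<Rightarrow> 'v set" where
  "visited_by N speed p \<tau> =
     {last (walk_nodes N (depot N) (take n p)) | n.
        n \<le> length p \<and> walk_len N (take n p) / speed \<le> \<tau>}"

text \<open>
  In what follows \<open>P i\<close> is the walk of truck \<open>i\<close> after it has reached the last node of its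
  segment. The routes of all vehicles, including the replanned parts of trucks that have
  reached their last segment node earlier, enter into the set of visited nodes.
\<close>

definition replan_time :: "'v network \<Rightarrow> 'v first_stage \<Rightarrow> nat \<Rightarrow> real" where
  "replan_time N F i = walk_len N (truck_out F i)"

definition visited_nodes ::
  "nat \<Rightarrow> real \<Rightarrow> 'v network \<Rightarrow> 'v first_stage \<Rightarrow> (nat \<Rightarrow> 'v route) \<Rightarrow> real \<Rightarrow> 'v set" where
  "visited_nodes kt \<alpha> N F P \<tau> =
     (\<Union>i<kt. visited_by N 1 (truck_out F i @ P i) \<tau> \<union>
        (\<Union>l \<in> {1..<length (segments F i)}. visited_by N \<alpha> (drone_tour F i l) \<tau>))"

definition damaged_left ::
  "'v network \<Rightarrow> 'v set \<Rightarrow> 'v first_stage \<Rightarrow> (nat \<Rightarrow> 'v route) \<Rightarrow> nat \<Rightarrow> 'v set" where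
  "damaged_left N D F P i =
     (D \<inter> set (node_seq F i)) -
     visited_by N 1 (truck_out F i @ P i) (replan_time N F i)"

definition unvisited_left ::
  "nat \<Rightarrow> real \<Rightarrow> 'v network \<Rightarrow> 'v first_stage \<Rightarrow> (nat \<Rightarrow> 'v route) \<Rightarrow> nat \<Rightarrow> 'v set" where
  "unvisited_left kt \<alpha> N F P i =
     set (node_seq F i) - visited_nodes kt \<alpha> N F P (replan_time N F i)"

definition shortest_return :: "'v network \<Rightarrow> 'v \<Rightarrow> 'v set \<Rightarrow> 'v route \<Rightarrow> bool" where
  "shortest_return N u W p \<longleftrightarrow>
     walk N u p (depot N) \<and> W \<subseteq> set (walk_nodes N u p) \<and>
     (\<forall>q. walk N u q (depot N) \<longrightarrow> W \<subseteq> set (walk_nodes N u q) \<longrightarrow> walk_len N p \<le> walk_len N q)"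

definition regretless_second_stage ::
  "nat \<Rightarrow> real \<Rightarrow> 'v network \<Rightarrow> 'v set \<Rightarrow> 'v first_stage \<Rightarrow> (nat \<Rightarrow> 'v route) \<Rightarrow> bool" where
  "regretless_second_stage kt \<alpha> N D F P \<longleftrightarrow>
     (\<forall>i<kt. shortest_return N
        (last (walk_nodes N (depot N) (truck_out F i)))
        (damaged_left N D F P i \<union> unvisited_left kt \<alpha> N F P i)
        (P i))"


section \<open>The policy\<close>

text \<open>
  A policy for given \<open>k\<^sup>t\<close>, \<open>k\<^sup>d\<close> and \<open>\<alpha>\<close>. The first stage sees only the network.
  The walk \<open>replan R N D i\<close> may depend on the damaged set only through what has been revealed
  when truck \<open>i\<close> replans; this is the last clause of \<open>regretless\<close>. Together with the
  deterministic first stage, the visited nodes and their statuses determine the whole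
  history up to that time. A policy satisfying \<open>regretless\<close> is Regretless with one
  particular way of breaking ties.
\<close>

record 'v policy =
  first :: "'v network \<Rightarrow> 'v first_stage"
  replan :: "'v network \<Rightarrow> 'v set \<Rightarrow> nat \<Rightarrow> 'v route"

definition known_nodes ::
  "nat \<Rightarrow> real \<Rightarrow> 'v policy \<Rightarrow> 'v network \<Rightarrow> 'v set \<Rightarrow> nat \<Rightarrow> 'v set" where
  "known_nodes kt \<alpha> R N D i =
     visited_nodes kt \<alpha> N (first R N) (replan R N D) (replan_time N (first R N) i)"

definition regretless :: "nat \<Rightarrow> nat \<Rightarrow> real \<Rightarrow> 'v policy \<Rightarrow> bool" where
  "regretless kt kd \<alpha> R \<longleftrightarrow>
     (\<forall>N. is_network N \<longrightarrow>
        regretless_first_stage kt kd \<alpha> N (first R N) \<and>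
        (\<forall>D \<subseteq> customers N. regretless_second_stage kt \<alpha> N D (first R N) (replan R N D)) \<and>
        (\<forall>D \<subseteq> customers N. \<forall>D' \<subseteq> customers N. \<forall>i<kt.
           known_nodes kt \<alpha> R N D i = known_nodes kt \<alpha> R N D' i \<longrightarrow>
           D \<inter> known_nodes kt \<alpha> R N D i = D' \<inter> known_nodes kt \<alpha> R N D' i \<longrightarrow>
           replan R N D i = replan R N D' i))"

definition completion_time ::
  "nat \<Rightarrow> real \<Rightarrow> 'v policy \<Rightarrow> 'v network \<Rightarrow> 'v set \<Rightarrow> real" where
  "completion_time kt \<alpha> R N D =
     (let F = first R N in
      Max (\<Union>i<kt. insert (walk_len N (truck_out F i @ replan R N D i))
             ((\<lambda>l. walk_len N (drone_tour F i l) / \<alpha>) ` {1..<length (segments F i)})))"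

definition best_case_ratio :: "nat \<Rightarrow> real \<Rightarrow> 'v policy \<Rightarrow> real" where
  "best_case_ratio kt \<alpha> R =
     Inf {completion_time kt \<alpha> R N D / TSP \<alpha> N kt 0 (customers N) | N D.
            is_network N \<and> D \<subseteq> customers N}"

end

(*
  On the complete network with unit lengths and n customers, the tour through m customers has
  length between m and m + 1, whatever their order, so nothing depends on how ties are broken.
  Take D empty. A truck and b drones can share m customers in time V = m / (1 + \<alpha> b) + O(1).
  Each drone handles at most \<alpha> V customers in an optimal split, which leaves V - O(1) for the
  truck; hence only O(1) customers are unvisited when the truck replans, and everybody is back by
  time V + O(1). The longest optimal tour has length TSP \<ge> max (m, n / kt), so the ratio is at
  most 1 / (1 + \<alpha> b) + O(1 / n).
*)
theory Submission
  imports Defs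
begin

section \<open>Walks in networks\<close>

lemma walk_len_conv: "walk_len N p = sum_list (map (edge_len N) p)"
proof -
  \<comment> \<open>\<open>awalk_cost_def\<close> carries the locale premise for an unrelated graph; any instance will do.\<close>
  have "wf_digraph (with_proj \<lparr>pverts = {} :: 'a set, parcs = {}\<rparr>)"
    by unfold_locales auto
  from wf_digraph.awalk_cost_def[OF this] show ?thesis
    by simp
qed

lemma walk_conv:
  "walk N u p v \<longleftrightarrow> u \<in> pverts (net_graph N) \<and> set p \<subseteq> parcs (net_graph N) \<and> pcas u p v"
  by (simp add: pre_digraph.awalk_def cas_with_proj_eq)

lemma walk_nodes_conv: "walk_nodes N = pawalk_verts"
  by (simp add: awalk_verts_with_proj_eq)

lemma written_as_walk_len: "written_as N ys p \<Longrightarrow> walk_len N p = seq_len N ys"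
  by (induction N ys p rule: written_as.induct) (auto simp: walk_len_conv)

lemma written_as_arcs: "written_as N ys p \<Longrightarrow> set p \<subseteq> parcs (net_graph N)"
  by (induction N ys p rule: written_as.induct) (force simp: walk_conv)+

lemma walk_len_nonneg:
  assumes "is_network N" "set p \<subseteq> parcs (net_graph N)"
  shows "walk_len N p \<ge> 0"
proof -
  have "edge_len N e \<ge> 0" if "e \<in> set p" for e
    using assms that by (cases e) (force simp: is_network_def)
  then show ?thesis
    unfolding walk_len_conv by (intro sum_list_nonneg) auto
qed

lemma pawalk_verts_zip: "ys \<noteq> [] \<Longrightarrow> pawalk_verts (hd ys) (zip ys (tl ys)) = ys"
  by (induction ys rule: induct_list012) auto

text \<open>\<open>zip ys (tl ys)\<close> lists the arcs between consecutive entries of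
  \<open>ys\<close>. Its first \<open>m\<close> arcs run through the first \<open>m + 1\<close>
  entries, so they end at index \<open>m\<close>.\<close>

lemma last_pawalk_verts_take_zip:
  assumes "m < length ys"
  shows "last (pawalk_verts (hd ys) (take m (zip ys (tl ys)))) = ys ! m"
proof -
  have "take m (zip ys (tl ys)) = zip (take (Suc m) ys) (tl (take (Suc m) ys))"
    by (rule nth_equalityI) (auto simp: nth_tl)
  moreover have "hd ys = hd (take (Suc m) ys)"
    by simp
  ultimately have "pawalk_verts (hd ys) (take m (zip ys (tl ys))) = take (Suc m) ys"
    using pawalk_verts_zip[of "take (Suc m) ys"] assms
    by (metis length_0_conv less_nat_zero_code take_eq_Nil Zero_not_Suc)
  then show ?thesis
    using assms by (simp add: take_Suc_conv_app_nth)
qed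

section \<open>Complete networks with unit lengths\<close>

text \<open>Loops are left out because \<open>pair_graph\<close> requires loop-freeness; equal nodes
  are therefore a case of their own for \<open>cdist\<close>.\<close>

definition complete_net :: "nat \<Rightarrow> nat network" where
  "complete_net n =
     \<lparr>net_graph = \<lparr>pverts = {..n}, parcs = {(u, v). u \<le> n \<and> v \<le> n \<and> u \<noteq> v}\<rparr>,
      depot = 0, edge_len = (\<lambda>_. 1)\<rparr>"

lemma complete_net_simps [simp]:
  "pverts (net_graph (complete_net n)) = {..n}"
  "parcs (net_graph (complete_net n)) = {(u, v). u \<le> n \<and> v \<le> n \<and> u \<noteq> v}"
  "depot (complete_net n) = 0"
  "edge_len (complete_net n) = (\<lambda>_. 1)"
  by (simp_all add: complete_net_def)

lemma customers_complete_net: "customers (complete_net n) = {1..n}"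
  by (auto simp: customers_def)

lemma awalk_cost_unit [simp]:
  fixes p :: "nat route"
  shows "wf_digraph.awalk_cost (\<lambda>_. 1) p = real (length p)"
  \<comment> \<open>Only the edge lengths of a network enter \<open>walk_len\<close>, and they are
    the same for every \<open>n\<close>.\<close>
  using walk_len_conv[of "complete_net 0" p] by (simp add: sum_list_triv)

lemma pair_graph_complete_net: "pair_graph (net_graph (complete_net n))"
proof
  show "finite (parcs (net_graph (complete_net n)))"
    by (rule finite_subset[of _ "{..n} \<times> {..n}"]) auto
qed (auto simp: symmetric_def sym_def)

text \<open>No arc joins a node to itself, so there \<open>cdist\<close> falls back on
  \<open>\<mu>\<close>, which is 0 by the empty walk and the nonnegative lengths.\<close>

lemma cdist_complete_net:
  assumes "u \<le> n" "v \<le> n"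
  shows "cdist (complete_net n) u v = (if u = v then 0 else 1)"
proof (cases "u = v")
  case True
  let ?N = "complete_net n"
  interpret pair_graph "net_graph ?N"
    by (rule pair_graph_complete_net)
  have "wf_digraph.\<mu> (with_proj (net_graph ?N)) (edge_len ?N) u u = 0"
    unfolding \<mu>_def
  proof (rule antisym)
    have "walk ?N u [] u"
      using assms by (simp add: walk_conv)
    then show "(INF p\<in>{p. walk ?N u p u}. ereal (walk_len ?N p)) \<le> 0"
      by (intro INF_lower2[of "[]"]) auto
    show "0 \<le> (INF p\<in>{p. walk ?N u p u}. ereal (walk_len ?N p))"
      by (rule INF_greatest) simp
  qed
  then show ?thesis
    using True by (simp add: cdist_def)
qed (use assms in \<open>simp add: cdist_def\<close>)

lemma is_network_complete_net:
  assumes "n \<ge> 1"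
  shows "is_network (complete_net n)"
proof -
  let ?G = "net_graph (complete_net n)"
  interpret pair_graph ?G
    by (rule pair_graph_complete_net)
  have "u \<rightarrow>\<^sup>*\<^bsub>mk_symmetric (with_proj ?G)\<^esub> v" if "u \<le> n" "v \<le> n" for u v
  proof (rule reachable_mk_symmetricI)
    show "u \<rightarrow>\<^sup>*\<^bsub>with_proj ?G\<^esub> v"
      using that by (cases "u = v") (auto intro: adj_in_verts reachable_refl reachable_adjI)
  qed
  then have "Digraph_Component.connected (with_proj ?G)"
    by (auto simp: Digraph_Component.connected_def intro!: strongly_connectedI)
  then show ?thesis
    using assms by (auto simp: is_network_def pair_graph_complete_net customers_complete_net
        cdist_complete_net)
qed

text \<open>Different nodes have distance 1, so the only shortest walk between them is a single arc
  and no choice of shortest paths remains. Equal consecutive nodes would yield the empty walk in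
  \<open>written_as\<close> but a loop in the \<open>zip\<close>.\<close>

lemma written_as_complete_net:
  assumes "written_as (complete_net n) ys p" "distinct_adj ys" "set ys \<subseteq> {..n}"
  shows "p = zip ys (tl ys)"
  using assms
proof (induction "complete_net n" ys p rule: written_as.induct)
  case (3 u v xs p)
  then obtain q r where qr: "p = q @ r" "walk (complete_net n) u q v"
    "length q = cdist (complete_net n) u v" "written_as (complete_net n) (v # xs) r"
    by auto
  with 3 have "r = zip (v # xs) xs"
    by (auto simp: distinct_adj_Cons)
  moreover have "length q = 1"
    using qr 3 by (auto simp: cdist_complete_net distinct_adj_Cons)
  then have "q = [(u, v)]"
    using qr(2) by (auto simp: length_Suc_conv walk_conv)
  ultimately show ?case
    using qr by simp
qed auto

lemma seq_len_complete_net: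
  assumes "set ys \<subseteq> {..n}" "distinct_adj ys"
  shows "seq_len (complete_net n) ys = real (length ys - 1)"
  using assms
  by (induction "complete_net n" ys rule: seq_len.induct)
     (auto simp: distinct_adj_Cons cdist_complete_net)

lemma distinct_imp_distinct_adj: "distinct xs \<Longrightarrow> distinct_adj xs"
  by (simp add: distinct_adj_altdef remdups_adj_distinct)

lemma distinct_adj_loop:
  assumes "distinct xs" "0 \<notin> set xs" "xs \<noteq> []"
  shows "distinct_adj (0 # xs @ [0])"
  using assms
  by (auto simp: distinct_adj_append_iff distinct_imp_distinct_adj distinct_adj_Cons hd_append
      dest: hd_in_set last_in_set)

text \<open>The closed tour has one arc more than customers, except that the empty tour has length
  0. The interval covers both cases.\<close>

lemma seq_len_loop_complete_net:
  assumes "distinct xs" "set xs \<subseteq> {1..n}"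
  shows "seq_len (complete_net n) (loop (complete_net n) xs) \<in> {real (length xs)..real (length xs) + 1}"
proof (cases "xs = []")
  case True
  then show ?thesis by (simp add: loop_def cdist_complete_net)
next
  case False
  then have "distinct_adj (0 # xs @ [0])"
    using assms by (intro distinct_adj_loop) auto
  then have "seq_len (complete_net n) (0 # xs @ [0]) = length xs + 1"
    using assms by (subst seq_len_complete_net) auto
  then show ?thesis by (simp add: loop_def)
qed

section \<open>Covering walks and arrival times\<close>

lemma ex_walk_complete_net:
  assumes "ys \<noteq> []" "set ys \<subseteq> {..n}"
  shows "\<exists>p. walk (complete_net n) (hd ys) p (last ys) \<and> set ys \<subseteq> set (pawalk_verts (hd ys) p) \<and>
    length p < length ys"
  using assms
proof (induction ys rule: induct_list012)
  case (3 u v ys)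
  then obtain p where p: "walk (complete_net n) v p (last (v # ys))"
    "set (v # ys) \<subseteq> set (pawalk_verts v p)" "length p < length (v # ys)"
    by auto
  show ?case
  proof (cases "u = v")
    case True
    with p show ?thesis by (intro exI[of _ p]) auto
  next
    case False
    with p 3 show ?thesis by (intro exI[of _ "(u, v) # p"]) (auto simp: walk_conv)
  qed
qed (auto simp: walk_conv intro: exI[of _ "[]"])

text \<open>A competitor visits \<open>W\<close> in any order and then goes to the depot, with at
  most one arc per node of \<open>W\<close> and one for the return.\<close>

lemma shortest_return_complete_net:
  assumes "shortest_return (complete_net n) u W p" "finite W" "W \<subseteq> {..n}"
  shows "length p \<le> card W + 1"
proof -
  obtain ws where ws: "set ws = W" "length ws = card W"
    using assms(2) by (metis finite_distinct_list distinct_card)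
  have "u \<le> n"
    using assms(1) by (simp add: shortest_return_def walk_conv)
  then obtain q where "walk (complete_net n) u q 0" "W \<subseteq> set (pawalk_verts u q)"
    "length q \<le> card W + 1"
    using ex_walk_complete_net[of "u # ws @ [0]" n] assms(3) ws by auto
  then show ?thesis
    using assms(1) unfolding shortest_return_def walk_nodes_conv by fastforce
qed

text \<open>With unit lengths the entry at index \<open>m\<close> is reached after \<open>m\<close>
  arcs, that is, at time \<open>m / speed\<close>. The continuation \<open>q\<close>, for a truck
  its replanned part, leaves this prefix unchanged.\<close>

lemma nth_visited_by_complete_net:
  assumes "written_as (complete_net n) (0 # ys) p" "distinct_adj (0 # ys)" "set ys \<subseteq> {..n}"
    and "m \<le> length ys" "real m / speed \<le> \<tau>"
  shows "(0 # ys) ! m \<in> visited_by (complete_net n) speed (p @ q) \<tau>"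
proof -
  have p: "p = zip (0 # ys) ys"
    using written_as_complete_net[OF assms(1,2)] assms(3) by simp
  then have "last (pawalk_verts 0 (take m (p @ q))) = (0 # ys) ! m"
    using last_pawalk_verts_take_zip[of m "0 # ys"] assms(4) by simp
  moreover have "m \<le> length (p @ q)" "length (take m (p @ q)) = m"
    using p assms(4) by auto
  ultimately show ?thesis
    using assms(5) unfolding visited_by_def
    by (intro CollectI exI[of _ m]) (simp add: walk_nodes_conv del: take_append length_take)
qed

section \<open>Splitting a tour\<close>

text \<open>Cut off blocks of \<open>m\<close> entries until nothing is left.\<close>

lemma ex_chunks:
  assumes "length xs \<le> k * m"
  shows "\<exists>S. concat S = xs \<and> [] \<notin> set S \<and> length S \<le> k \<and> (\<forall>s\<in>set S. length s \<le> m)"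
  using assms
proof (induction k arbitrary: xs)
  case (Suc k)
  show ?case
  proof (cases "xs = []")
    case False
    from Suc obtain S where S: "concat S = drop m xs" "[] \<notin> set S" "length S \<le> k"
      "\<forall>s\<in>set S. length s \<le> m"
      by (metis length_drop le_diff_conv mult_Suc add.commute)
    have "m \<noteq> 0"
      using Suc.prems False by (intro notI) simp
    with False S show ?thesis
      by (intro exI[of _ "take m xs # S"]) auto
  qed (auto intro: exI[of _ "[]"])
qed auto

lemma split_value_ge:
  assumes "s \<in> set (tl S)"
  shows "seq_len N (loop N (rev s)) / \<alpha> \<le> split_value \<alpha> N S"
  unfolding split_value_def using assms by (intro Max_ge) auto

lemma split_value_ge_truck: "seq_len N (loop N (truck_segment S)) \<le> split_value \<alpha> N S"
  unfolding split_value_def by (intro Max_ge) auto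

lemma split_value_complete_net_le:
  assumes "\<alpha> > 0" "distinct (concat S)" "set (concat S) \<subseteq> {1..n}"
    and "real (length (truck_segment S)) + 1 \<le> B"
    and "\<And>s. s \<in> set (tl S) \<Longrightarrow> (real (length s) + 1) / \<alpha> \<le> B"
  shows "split_value \<alpha> (complete_net n) S \<le> B"
proof -
  \<comment> \<open>The empty list is included because \<open>truck_segment\<close> returns it for
    an empty split.\<close>
  have seg: "distinct s \<and> set s \<subseteq> {1..n}" if "s \<in> set S \<or> s = []" for s
    using that assms(2,3) by (auto simp: distinct_concat_iff)
  have "seq_len (complete_net n) (loop (complete_net n) (truck_segment S)) \<le> B"
    using seq_len_loop_complete_net[of "truck_segment S" n] assms(4) seg[of "truck_segment S"]
    by (auto simp: truck_segment_def split: list.splits)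
  moreover have "seq_len (complete_net n) (loop (complete_net n) (rev s)) / \<alpha> \<le> B"
    if s: "s \<in> set (tl S)" for s
  proof -
    have "distinct s \<and> set s \<subseteq> {1..n}"
      using s by (intro seg) (cases S; auto)
    then have "seq_len (complete_net n) (loop (complete_net n) (rev s)) \<le> real (length s) + 1"
      using seq_len_loop_complete_net[of "rev s" n] by simp
    then have "seq_len (complete_net n) (loop (complete_net n) (rev s)) / \<alpha> \<le> (real (length s) + 1) / \<alpha>"
      using assms(1) by (intro divide_right_mono) auto
    with assms(5)[OF s] show ?thesis by linarith
  qed
  ultimately show ?thesis
    unfolding split_value_def by (subst Max_le_iff) auto
qed

text \<open>The optimal split is no worse than one in which the truck takes at most \<open>a\<close>
  customers and each of at most \<open>b\<close> drones at most \<open>m\<close>. Rounding up and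
  the extra arc of the closed tour cost at most 2 for the truck and \<open>2 / \<alpha>\<close> for
  a drone; their sum covers both.\<close>

lemma optimal_split_complete_net_le:
  assumes "\<alpha> > 0" "distinct xs" "set xs \<subseteq> {1..n}"
    and opt: "optimal_split \<alpha> (complete_net n) xs (1 + b) S"
  shows "split_value \<alpha> (complete_net n) S \<le> length xs / (1 + \<alpha> * b) + (2 + 2 / \<alpha>)"
proof (cases "xs = []")
  case True
  have "split_value \<alpha> (complete_net n) S \<le> split_value \<alpha> (complete_net n) []"
    using opt True by (auto simp: optimal_split_def is_split_def)
  also have "\<dots> \<le> 2 + 2 / \<alpha>"
    using assms(1) by (intro split_value_complete_net_le) (auto simp: truck_segment_def)
  finally show ?thesis
    using True by simp
next
  case False
  \<comment> \<open>\<open>x\<close> solves \<open>x + b * (\<alpha> * x) = length xs\<close>: up to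
    rounding and the return, this is the time a truck of speed 1 and \<open>b\<close> drones of
    speed \<alpha> need when they share the customers evenly by speed.\<close>
  define x where "x = length xs / (1 + \<alpha> * b)"
  define a where "a = nat \<lceil>x\<rceil>"
  define m where "m = nat \<lceil>\<alpha> * x\<rceil>"
  have pos: "1 + \<alpha> * b > 0"
    using assms(1) by (simp add: add_pos_nonneg)
  have x: "x > 0"
    using False pos by (simp add: x_def)
  have a: "x \<le> a" "a \<le> x + 1"
    unfolding a_def using x by linarith+
  have m: "\<alpha> * x \<le> m" "m \<le> \<alpha> * x + 1"
    unfolding m_def using x assms(1)
    by (smt (verit) mult_pos_pos of_nat_nat of_int_ceiling_le_add_one le_of_int_ceiling zero_le_ceiling)+
  have "x * (1 + \<alpha> * b) = length xs"
    using pos by (simp add: x_def)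
  then have "real (length xs) = x + b * (\<alpha> * x)"
    by (simp add: algebra_simps)
  also have "\<dots> \<le> real a + real b * real m"
    using a m by (intro add_mono mult_left_mono) auto
  finally have "length xs \<le> a + b * m"
    by (metis of_nat_add of_nat_le_iff of_nat_mult)
  then have "length (drop a xs) \<le> b * m"
    by simp
  then obtain S' where S': "concat S' = drop a xs" "[] \<notin> set S'" "length S' \<le> b"
    "\<forall>s\<in>set S'. length s \<le> m"
    using ex_chunks by blast
  have "a > 0"
    using a x by (cases a) auto
  then have "is_split xs (1 + b) (take a xs # S')"
    using S' False by (auto simp: is_split_def)
  then have "split_value \<alpha> (complete_net n) S \<le> split_value \<alpha> (complete_net n) (take a xs # S')"
    using opt by (simp add: optimal_split_def)
  also have "\<dots> \<le> x + (2 + 2 / \<alpha>)"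
  proof (rule split_value_complete_net_le)
    have "real (length (take a xs)) \<le> x + 1"
      using a by simp
    moreover have "2 / \<alpha> > 0"
      using assms(1) by simp
    ultimately show "real (length (truck_segment (take a xs # S'))) + 1 \<le> x + (2 + 2 / \<alpha>)"
      unfolding truck_segment_def list.case by linarith
  next
    fix s assume "s \<in> set (tl (take a xs # S'))"
    then have "real (length s) \<le> m"
      using S' by simp
    then have "real (length s) + 1 \<le> \<alpha> * (x + (2 + 2 / \<alpha>))"
      using m assms(1) by (simp add: algebra_simps)
    then show "(real (length s) + 1) / \<alpha> \<le> x + (2 + 2 / \<alpha>)"
      using assms(1) by (simp add: divide_le_eq mult.commute)
  qed (use assms S' in auto)
  finally show ?thesis
    by (simp add: x_def)
qed

section \<open>Runs of the policy on complete networks\<close>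

text \<open>The tours of the first stage form an optimal family and so attain the infimum; with no
  drone tours the makespan is a maximum over the trucks alone.\<close>

lemma TSP_regretless:
  assumes "regretless_first_stage kt kd \<alpha> N F"
  shows "TSP \<alpha> N kt 0 (customers N) = Max ((\<lambda>i. walk_len N (opt_tour F i)) ` {..<kt})"
  using assms by (simp add: regretless_first_stage_def optimal_family_def makespan_def)

text \<open>Edge lengths are positive, and truck 0 bounds both maxima from below. The set of ratios
  is thus bounded below, as \<open>cInf_lower\<close> requires.\<close>

lemma completion_ratio_nonneg:
  assumes "regretless kt kd \<alpha> R" "kt \<ge> 1" "is_network N" "D \<subseteq> customers N"
  shows "completion_time kt \<alpha> R N D / TSP \<alpha> N kt 0 (customers N) \<ge> 0"
proof -
  define F where "F = first R N"
  have F: "regretless_first_stage kt kd \<alpha> N F"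
    and "regretless_second_stage kt \<alpha> N D F (replan R N D)"
    using assms unfolding regretless_def F_def by blast+
  then have "set (opt_tour F 0) \<subseteq> parcs (net_graph N)"
    "set (truck_out F 0 @ replan R N D 0) \<subseteq> parcs (net_graph N)"
    using assms(2) by (auto simp: regretless_first_stage_def regretless_second_stage_def
        shortest_return_def walk_conv dest!: spec[of _ 0] written_as_arcs)
  then have nonneg: "walk_len N (opt_tour F 0) \<ge> 0"
    "walk_len N (truck_out F 0 @ replan R N D 0) \<ge> 0"
    using walk_len_nonneg[OF assms(3)] by blast+
  have "walk_len N (truck_out F 0 @ replan R N D 0) \<le> completion_time kt \<alpha> R N D"
    unfolding completion_time_def Let_def F_def[symmetric] using assms(2)
    by (intro Max_ge) auto
  moreover have "walk_len N (opt_tour F 0) \<le> TSP \<alpha> N kt 0 (customers N)"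
    unfolding TSP_regretless[OF F] using assms(2) by (intro Max_ge) auto
  ultimately show ?thesis
    using nonneg by simp
qed

lemma best_case_ratio_le:
  assumes "regretless kt kd \<alpha> R" "kt \<ge> 1" "is_network N" "D \<subseteq> customers N"
  shows "best_case_ratio kt \<alpha> R \<le> completion_time kt \<alpha> R N D / TSP \<alpha> N kt 0 (customers N)"
  unfolding best_case_ratio_def
proof (rule cInf_lower)
  show "bdd_below {completion_time kt \<alpha> R N D / TSP \<alpha> N kt 0 (customers N) | N D.
      is_network N \<and> D \<subseteq> customers N}"
    using completion_ratio_nonneg[OF assms(1,2)] by (intro bdd_belowI[of _ 0]) blast
qed (use assms in blast)

section \<open>A run with no damaged nodes\<close>

text \<open>With an empty damaged set a truck replans only for nodes that no vehicle has visited.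
  \<open>b\<close> is the number of drones per tour.\<close>

locale complete_run =
  fixes kt kd b n :: nat and \<alpha> :: real and F :: "nat first_stage" and P :: "nat \<Rightarrow> nat route"
  assumes n: "n \<ge> 1" and kt: "kt \<ge> 1" and \<alpha>: "\<alpha> > 0"
    and ratio: "real kd / real kt = real b"
    and first_stage: "regretless_first_stage kt kd \<alpha> (complete_net n) F"
    and second_stage: "regretless_second_stage kt \<alpha> (complete_net n) {} F P"
begin

abbreviation "N \<equiv> complete_net n"

lemma distinct_node_seqs: "distinct (concat (map (node_seq F) [0..<kt]))"
  and set_node_seqs: "set (concat (map (node_seq F) [0..<kt])) = {1..n}"
  using first_stage by (simp_all only: regretless_first_stage_def customers_complete_net)

lemma node_seq:
  assumes "i < kt"
  shows "distinct (node_seq F i)" "set (node_seq F i) \<subseteq> {1..n}"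
proof -
  have mem: "node_seq F i \<in> set (map (node_seq F) [0..<kt])"
    using assms by simp
  then show "distinct (node_seq F i)"
    using distinct_node_seqs by (simp only: distinct_concat_iff)
  show "set (node_seq F i) \<subseteq> {1..n}"
    using mem unfolding set_node_seqs[symmetric] by (simp only: set_concat) blast
qed

lemma concat_segments: "i < kt \<Longrightarrow> concat (segments F i) = node_seq F i"
  using first_stage by (simp add: regretless_first_stage_def optimal_split_def is_split_def)

text \<open>The ratio is an integer, so floor and ceiling agree and every tour gets exactly
  \<open>b\<close> drones.\<close>

lemma optimal_segments:
  "i < kt \<Longrightarrow> optimal_split \<alpha> N (node_seq F i) (1 + b) (segments F i)"
  using first_stage ratio by (auto simp: regretless_first_stage_def)

lemma length_segments: "i < kt \<Longrightarrow> length (segments F i) \<le> 1 + b"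
  using optimal_segments by (simp add: optimal_split_def is_split_def)

lemma segment:
  assumes "i < kt" "s \<in> set (segments F i)"
  shows "distinct s" "set s \<subseteq> {1..n}" "s \<noteq> []"
proof -
  show "distinct s"
    using node_seq(1)[OF assms(1)] assms(2)
    by (simp add: concat_segments[OF assms(1), symmetric] distinct_concat_iff)
  show "set s \<subseteq> {1..n}"
    using node_seq(2)[OF assms(1)] assms(2)
    by (force simp add: concat_segments[OF assms(1), symmetric])
  show "s \<noteq> []"
    using optimal_segments[OF assms(1)] assms(2) by (auto simp: optimal_split_def is_split_def)
qed

lemma truck_segment_props:
  assumes "i < kt"
  shows "distinct (truck_segment (segments F i))" "set (truck_segment (segments F i)) \<subseteq> {1..n}"
proof -
  let ?s = "truck_segment (segments F i)"
  have "?s = [] \<or> ?s \<in> set (segments F i)"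
    by (auto simp: truck_segment_def split: list.split)
  then show "distinct ?s" "set ?s \<subseteq> {1..n}"
    using segment(1,2)[OF assms, of ?s] by auto
qed

lemma sum_length_node_seq: "(\<Sum>i<kt. length (node_seq F i)) = n"
proof -
  have "(\<Sum>i<kt. length (node_seq F i)) = length (concat (map (node_seq F) [0..<kt]))"
    by (simp add: length_concat interv_sum_list_conv_sum_set_nat atLeast0LessThan comp_def)
  also have "\<dots> = card {1..n}"
    using distinct_node_seqs set_node_seqs by (metis distinct_card)
  finally show ?thesis by simp
qed

lemma length_node_seq_le_TSP:
  assumes "i < kt"
  shows "length (node_seq F i) \<le> TSP \<alpha> N kt 0 (customers N)"
proof -
  have "written_as N (loop N (node_seq F i)) (opt_tour F i)"
    using first_stage assms by (simp add: regretless_first_stage_def)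
  from written_as_walk_len[OF this] have "length (node_seq F i) \<le> walk_len N (opt_tour F i)"
    using seq_len_loop_complete_net[OF node_seq[OF assms]] by simp
  also have "\<dots> \<le> TSP \<alpha> N kt 0 (customers N)"
    unfolding TSP_regretless[OF first_stage] using assms by (intro Max_ge) auto
  finally show ?thesis .
qed

text \<open>Averaging: the \<open>kt\<close> node sequences contain \<open>n\<close> customers in
  all, and none is longer than the optimal makespan. The makespan thus grows with \<open>n\<close>,
  which makes additive constants negligible in the ratio.\<close>

lemma TSP_ge: "n / kt \<le> TSP \<alpha> N kt 0 (customers N)"
proof -
  have "real n = (\<Sum>i<kt. real (length (node_seq F i)))"
    using sum_length_node_seq by (metis of_nat_sum)
  also have "\<dots> \<le> kt * TSP \<alpha> N kt 0 (customers N)"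
    using sum_bounded_above[of "{..<kt}" "\<lambda>i. real (length (node_seq F i))"]
      length_node_seq_le_TSP by auto
  finally show ?thesis
    using kt by (simp add: divide_le_eq mult.commute)
qed

section \<open>Loads and the value of a split\<close>

abbreviation value_of :: "nat \<Rightarrow> real" where
  "value_of i \<equiv> split_value \<alpha> N (segments F i)"

abbreviation truck_load :: "nat \<Rightarrow> nat" where
  "truck_load i \<equiv> length (truck_segment (segments F i))"

lemma truck_load_le: "i < kt \<Longrightarrow> truck_load i \<le> value_of i"
  using seq_len_loop_complete_net[OF truck_segment_props]
    split_value_ge_truck[of N "segments F i" \<alpha>] by fastforce

lemma drone_load_le:
  assumes "i < kt" "s \<in> set (tl (segments F i))"
  shows "length s \<le> \<alpha> * value_of i"
proof -
  have "s \<in> set (segments F i)"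
    using assms(2) by (cases "segments F i") auto
  then have "length s \<le> seq_len N (loop N (rev s))"
    using seq_len_loop_complete_net[of "rev s" n] segment[OF assms(1)] by simp
  then show ?thesis
    using split_value_ge[OF assms(2), of N \<alpha>] \<alpha> by (simp add: divide_le_eq mult.commute)
qed

lemma drone_tour_le:
  assumes "i < kt" "l \<in> {1..<length (segments F i)}"
  shows "walk_len N (drone_tour F i l) / \<alpha> \<le> value_of i"
proof -
  have "written_as N (loop N (rev (segments F i ! l))) (drone_tour F i l)"
    using first_stage assms by (simp add: regretless_first_stage_def)
  moreover have "segments F i ! l \<in> set (tl (segments F i))"
    using assms(2) by (cases "segments F i") (auto simp: nth_Cons')
  ultimately show ?thesis
    using split_value_ge written_as_walk_len by metis
qed

text \<open>At most \<open>b\<close> drones take at most \<open>\<alpha> * value_of i\<close>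
  customers each, and the truck takes the rest. Read as a lower bound on the truck load, this will
  force the load close to the split value.\<close>

lemma node_seq_le:
  assumes "i < kt"
  shows "length (node_seq F i) \<le> truck_load i + b * (\<alpha> * value_of i)"
proof -
  let ?S = "segments F i"
  have nonneg: "value_of i \<ge> 0"
    using truck_load_le[OF assms] by linarith
  have "length (node_seq F i) = truck_load i + (\<Sum>s\<leftarrow>tl ?S. length s)"
    unfolding concat_segments[OF assms, symmetric]
    by (cases ?S) (auto simp: truck_segment_def length_concat)
  moreover have "real (\<Sum>s\<leftarrow>ss. length s) \<le> (\<Sum>s\<leftarrow>ss. \<alpha> * value_of i)"
    if "set ss \<subseteq> set (tl ?S)" for ss
    using that by (induction ss) (auto intro!: add_mono drone_load_le[OF assms])
  then have "real (\<Sum>s\<leftarrow>tl ?S. length s) \<le> (\<Sum>s\<leftarrow>tl ?S. \<alpha> * value_of i)"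
    by blast
  moreover have "(\<Sum>s\<leftarrow>tl ?S. \<alpha> * value_of i) \<le> b * (\<alpha> * value_of i)"
    unfolding sum_list_triv using length_segments[OF assms] nonneg \<alpha>
    by (intro mult_right_mono) auto
  ultimately show ?thesis by simp
qed

lemma truck_out:
  assumes "i < kt"
  shows "written_as N (0 # truck_segment (segments F i)) (truck_out F i)"
    "distinct_adj (0 # truck_segment (segments F i))"
    "length (truck_out F i) = truck_load i"
proof -
  show w: "written_as N (0 # truck_segment (segments F i)) (truck_out F i)"
    using first_stage assms by (simp add: regretless_first_stage_def)
  have "distinct (0 # truck_segment (segments F i))"
    using truck_segment_props[OF assms] by auto
  then show d: "distinct_adj (0 # truck_segment (segments F i))"
    by (rule distinct_imp_distinct_adj)
  show "length (truck_out F i) = truck_load i"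
    using written_as_complete_net[OF w d] truck_segment_props(2)[OF assms] by fastforce
qed

section \<open>Nodes left when a truck replans\<close>

text \<open>The depot has index 0 in the walk, so entry \<open>k\<close> of the reversed segment is
  reached after \<open>k + 1\<close> arcs.\<close>

lemma drone_visited:
  assumes "i < kt" "l \<in> {1..<length (segments F i)}"
    and "k < nat \<lfloor>\<alpha> * \<tau>\<rfloor>" "k < length (segments F i ! l)"
  shows "rev (segments F i ! l) ! k \<in> visited_by N \<alpha> (drone_tour F i l) \<tau>"
proof -
  let ?s = "rev (segments F i ! l)"
  have s: "segments F i ! l \<in> set (segments F i)"
    using assms(2) by simp
  have "written_as N (0 # ?s @ [0]) (drone_tour F i l)"
    using first_stage assms by (simp add: regretless_first_stage_def loop_def)
  moreover have "distinct_adj (0 # ?s @ [0])"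
    using segment[OF assms(1) s] by (intro distinct_adj_loop) auto
  moreover have "real (Suc k) \<le> \<alpha> * \<tau>"
    using assms(3) by linarith
  then have "real (Suc k) / \<alpha> \<le> \<tau>"
    using \<alpha> by (simp add: divide_le_eq mult.commute)
  ultimately have "(0 # ?s @ [0]) ! Suc k \<in> visited_by N \<alpha> (drone_tour F i l @ []) \<tau>"
    using segment[OF assms(1) s] assms(4) by (intro nth_visited_by_complete_net) auto
  then show ?thesis
    using assms(4) by (simp add: nth_append)
qed

text \<open>At replanning time, which is the truck load by unit lengths, the truck has finished its
  own segment and each drone of the tour has passed the first entries of its reversed segment.
  Vehicles of other tours can only shrink the set further.\<close>

lemma unvisited_subset:
  assumes "i < kt"
  shows "unvisited_left kt \<alpha> N F P i \<subseteq>
    (\<Union>l\<in>{1..<length (segments F i)}. set (drop (nat \<lfloor>\<alpha> * truck_load i\<rfloor>) (rev (segments F i ! l))))"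
proof
  fix v assume v: "v \<in> unvisited_left kt \<alpha> N F P i"
  define \<tau> where "\<tau> = real (truck_load i)"
  let ?f = "nat \<lfloor>\<alpha> * \<tau>\<rfloor>"
  have \<tau>: "replan_time N F i = \<tau>"
    using truck_out(3)[OF assms] by (simp add: replan_time_def \<tau>_def)
  have not_visited: "v \<notin> visited_by N 1 (truck_out F i @ P i) \<tau>"
    "\<And>l. l \<in> {1..<length (segments F i)} \<Longrightarrow> v \<notin> visited_by N \<alpha> (drone_tour F i l) \<tau>"
    using v assms unfolding unvisited_left_def visited_nodes_def \<tau> by blast+
  have "v \<in> set (concat (segments F i))"
    using v by (simp add: unvisited_left_def concat_segments[OF assms])
  then obtain s where "s \<in> set (segments F i)" "v \<in> set s"
    by auto
  then obtain l where l: "l < length (segments F i)" "v \<in> set (segments F i ! l)"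
    by (metis in_set_conv_nth)
  have "l \<noteq> 0"
  proof
    assume "l = 0"
    with l have "v \<in> set (truck_segment (segments F i))"
      by (cases "segments F i") (auto simp: truck_segment_def)
    then obtain m where m: "m < truck_load i" "truck_segment (segments F i) ! m = v"
      by (auto simp: in_set_conv_nth)
    then have "(0 # truck_segment (segments F i)) ! Suc m \<in> visited_by N 1 (truck_out F i @ P i) \<tau>"
      using truck_out[OF assms] truck_segment_props[OF assms]
      by (intro nth_visited_by_complete_net) (auto simp: \<tau>_def)
    with m not_visited show False by simp
  qed
  with l have l': "l \<in> {1..<length (segments F i)}"
    by simp
  obtain k where k: "k < length (segments F i ! l)" "rev (segments F i ! l) ! k = v"
    using l(2) by (metis in_set_conv_nth length_rev set_rev)
  with drone_visited[OF assms l'] not_visited(2)[OF l'] have "\<not> k < ?f"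
    by blast
  then have "v \<in> set (drop ?f (rev (segments F i ! l)))"
    using k by (auto simp: in_set_conv_nth intro!: exI[of _ "k - ?f"])
  with l' show "v \<in> (\<Union>l\<in>{1..<length (segments F i)}.
      set (drop (nat \<lfloor>\<alpha> * truck_load i\<rfloor>) (rev (segments F i ! l))))"
    unfolding \<tau>_def by blast
qed

text \<open>A drone segment has at most \<open>\<alpha> * value_of i\<close> nodes, and rounding
  \<open>\<alpha> * truck_load i\<close> down costs at most one node per drone.\<close>

lemma card_unvisited_le:
  assumes "i < kt"
  shows "card (unvisited_left kt \<alpha> N F P i) \<le> b * (\<alpha> * value_of i - \<alpha> * truck_load i + 1)"
proof -
  let ?S = "segments F i"
  let ?f = "nat \<lfloor>\<alpha> * truck_load i\<rfloor>"
  let ?B = "\<alpha> * value_of i - \<alpha> * truck_load i + 1"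
  \<comment> \<open>This covers drones that have finished their segment, where the subtraction is
    truncated, and tours with fewer than \<open>b\<close> drone segments.\<close>
  have B: "?B \<ge> 0"
    using truck_load_le[OF assms] \<alpha> by (simp add: mult_left_mono add_nonneg_nonneg)
  have seg: "card (set (drop ?f (rev (?S ! l)))) \<le> ?B" if "l \<in> {1..<length ?S}" for l
  proof -
    have "?S ! l \<in> set (tl ?S)"
      using that by (cases ?S) (auto simp: nth_Cons')
    note drone_load_le[OF assms this]
    moreover have "card (set (drop ?f (rev (?S ! l)))) \<le> length (?S ! l) - ?f"
      by (metis card_length length_drop length_rev)
    moreover have "real ?f \<ge> \<alpha> * truck_load i - 1"
      using \<alpha> by linarith
    ultimately show ?thesis
      using B by linarith
  qed
  have "card (unvisited_left kt \<alpha> N F P i) \<le> card (\<Union>l\<in>{1..<length ?S}. set (drop ?f (rev (?S ! l))))"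
    using unvisited_subset[OF assms] by (intro card_mono) auto
  also have "\<dots> \<le> (\<Sum>l\<in>{1..<length ?S}. card (set (drop ?f (rev (?S ! l)))))"
    by (rule card_UN_le) auto
  finally have "real (card (unvisited_left kt \<alpha> N F P i)) \<le>
      (\<Sum>l\<in>{1..<length ?S}. real (card (set (drop ?f (rev (?S ! l))))))"
    by (metis of_nat_le_iff of_nat_sum)
  also have "\<dots> \<le> (\<Sum>l\<in>{1..<length ?S}. ?B)"
    using seg by (rule sum_mono)
  also have "\<dots> \<le> b * ?B"
    using length_segments[OF assms] B by (simp del: of_nat_diff) (intro mult_right_mono; simp)
  finally show ?thesis .
qed

section \<open>Completion time\<close>

lemma truck_route_le:
  assumes "i < kt"
  shows "walk_len N (truck_out F i @ P i) \<le>
    truck_load i + b * (\<alpha> * value_of i - \<alpha> * truck_load i + 1) + 1"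
proof -
  let ?W = "unvisited_left kt \<alpha> N F P i"
  have "shortest_return N (last (walk_nodes N 0 (truck_out F i))) ?W (P i)"
    using second_stage assms by (simp add: regretless_second_stage_def damaged_left_def)
  moreover have "?W \<subseteq> {..n}"
    using node_seq(2)[OF assms] by (auto simp: unvisited_left_def)
  ultimately have "length (P i) \<le> card ?W + 1"
    by (intro shortest_return_complete_net) (auto intro: finite_subset)
  then show ?thesis
    using card_unvisited_le[OF assms] truck_out(3)[OF assms] by simp
qed

text \<open>With \<open>c = 1 + \<alpha> * b\<close> and \<open>K = 2 + 2 / \<alpha>\<close> this is
  \<open>c * K + \<alpha> * b * (c * K) + b + 1\<close>. The first term absorbs the error
  \<open>K\<close> of the split value, the others bound the arcs that replanning adds to the truck
  load.\<close>

definition slack :: real where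
  "slack = (1 + \<alpha> * b) * (1 + \<alpha> * b) * (2 + 2 / \<alpha>) + b + 1"

text \<open>Let \<open>V\<close> be the split value, \<open>a\<close> the truck load and
  \<open>L\<close> the number of customers of the tour. From \<open>V \<le> L / c + K\<close> and
  \<open>L \<le> a + \<alpha> * b * V\<close> with \<open>c = 1 + \<alpha> * b\<close>, the terms
  \<open>\<alpha> * b * V\<close> cancel and leave \<open>V - a \<le> K * c\<close>. The truck is
  thus busy almost as long as the drones, and few nodes remain for it to fetch.\<close>

lemma truck_and_drones_le:
  assumes "i < kt"
  shows "max (value_of i) (walk_len N (truck_out F i @ P i)) \<le>
    TSP \<alpha> N kt 0 (customers N) / (1 + \<alpha> * b) + slack"
proof -
  let ?c = "1 + \<alpha> * b" and ?K = "2 + 2 / \<alpha>" and ?V = "value_of i" and ?a = "real (truck_load i)"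
  let ?T = "TSP \<alpha> N kt 0 (customers N)"
  have c: "?c \<ge> 1" and K: "?K \<ge> 0"
    using \<alpha> by simp_all
  have V: "?V \<le> length (node_seq F i) / ?c + ?K"
    using optimal_split_complete_net_le[OF \<alpha> node_seq[OF assms] optimal_segments[OF assms]] .
  then have "?V \<le> (?a + b * (\<alpha> * ?V)) / ?c + ?K"
    using node_seq_le[OF assms] c by (smt (verit) divide_right_mono)
  then have "?V * ?c \<le> ?a + b * (\<alpha> * ?V) + ?K * ?c"
    using c by (simp add: field_simps)
  then have "?V - ?a \<le> ?K * ?c"
    by (simp add: algebra_simps)
  then have "\<alpha> * b * (?V - ?a) \<le> \<alpha> * b * (?K * ?c)"
    using \<alpha> by (intro mult_left_mono) auto
  moreover have "?K * ?c \<ge> ?K"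
    using c K by (simp add: mult_le_cancel_left1)
  moreover have "slack = ?K * ?c + \<alpha> * b * (?K * ?c) + b + 1"
    by (simp only: slack_def) (simp only: algebra_simps)
  moreover have "\<alpha> * b * (?K * ?c) \<ge> 0"
    using \<alpha> K c by simp
  moreover have "length (node_seq F i) / ?c \<le> ?T / ?c"
    using length_node_seq_le_TSP[OF assms] c by (intro divide_right_mono) auto
  moreover have "walk_len N (truck_out F i @ P i) \<le> ?a + \<alpha> * b * (?V - ?a) + b + 1"
    using truck_route_le[OF assms] by (simp add: algebra_simps)
  ultimately show ?thesis
    using V truck_load_le[OF assms] by linarith
qed

text \<open>Drone tours last at most \<open>value_of i\<close>, which is why
  \<open>truck_and_drones_le\<close> bounds a maximum.\<close>

lemma completion_le:
  "Max (\<Union>i<kt. insert (walk_len N (truck_out F i @ P i))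
       ((\<lambda>l. walk_len N (drone_tour F i l) / \<alpha>) ` {1..<length (segments F i)})) \<le>
    TSP \<alpha> N kt 0 (customers N) / (1 + \<alpha> * b) + slack"
  using kt truck_and_drones_le drone_tour_le
  by (subst Max_le_iff) (fastforce simp del: complete_net_simps awalk_cost_unit)+

end

section \<open>Passage to the limit\<close>

theorem lemma10:
  fixes kt kd :: nat and \<alpha> :: real and R :: "nat policy"
  assumes "kt \<ge> 1" and "kd \<ge> 1"
    and "real kd / real kt \<in> \<int>"
    and "\<alpha> > 0"
    and "regretless kt kd \<alpha> R"
  shows "best_case_ratio kt \<alpha> R \<le> 1 / (1 + \<alpha> * (real kd / real kt))"
proof -
  have "real kd / real kt \<in> \<nat>"
    using assms(3) by (simp add: Nats_altdef2)
  then obtain b where b: "real kd / real kt = real b"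
    by (auto elim: Nats_cases)
  \<comment> \<open>The slack depends on \<open>b\<close> and \<alpha> only, so one constant serves
    all \<open>n\<close>.\<close>
  define K where "K = complete_run.slack b \<alpha>"
  have bound: "best_case_ratio kt \<alpha> R \<le> 1 / (1 + \<alpha> * b) + K * kt / n" if n: "n \<ge> 1" for n :: nat
  proof -
    let ?N = "complete_net n"
    have net: "is_network ?N"
      using n by (rule is_network_complete_net)
    have "regretless_first_stage kt kd \<alpha> ?N (first R ?N)"
      "regretless_second_stage kt \<alpha> ?N {} (first R ?N) (replan R ?N {})"
      using assms(5) net unfolding regretless_def by blast+
    then interpret complete_run kt kd b n \<alpha> "first R ?N" "replan R ?N {}"
      using assms n b by unfold_locales auto
    let ?T = "TSP \<alpha> ?N kt 0 (customers ?N)"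
    have "K \<ge> 0"
      using assms(4) by (simp add: K_def slack_def)
    have "n / kt > 0"
      using n assms(1) by simp
    then have "?T > 0"
      using TSP_ge by linarith
    have "best_case_ratio kt \<alpha> R \<le> completion_time kt \<alpha> R ?N {} / ?T"
      using best_case_ratio_le[OF assms(5,1) net] by blast
    also have "\<dots> \<le> (?T / (1 + \<alpha> * b) + K) / ?T"
      using completion_le \<open>?T > 0\<close> unfolding completion_time_def Let_def K_def
      by (intro divide_right_mono) auto
    also have "\<dots> = 1 / (1 + \<alpha> * b) + K / ?T"
      using \<open>?T > 0\<close> by (simp add: add_divide_distrib)
    \<comment> \<open>The lower bound on the optimal makespan turns the additive error into one of
      order \<open>1 / n\<close>.\<close>
    also have "K / ?T \<le> K / (n / kt)"
      using TSP_ge \<open>K \<ge> 0\<close> \<open>n / kt > 0\<close> by (intro divide_left_mono mult_pos_pos \<open>?T > 0\<close>)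
    finally show ?thesis by simp
  qed
  \<comment> \<open>The left side of \<open>bound\<close> does not depend on \<open>n\<close>, so
    letting \<open>n\<close> grow removes the error term.\<close>
  have "(\<lambda>n. 1 / (1 + \<alpha> * b) + K * kt / real n) \<longlonglongrightarrow> 1 / (1 + \<alpha> * b) + 0"
    by (intro tendsto_intros lim_const_over_n)
  moreover have "\<exists>n0. \<forall>n\<ge>n0. best_case_ratio kt \<alpha> R \<le> 1 / (1 + \<alpha> * b) + K * kt / real n"
    using bound by blast
  ultimately show ?thesis
    unfolding b by (intro LIMSEQ_le_const[of _ "1 / (1 + \<alpha> * b)"]) auto
qed

end
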